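(* (1) Let $1\le q<p\le\infty$. Then the norm $\lVert\cdot\rVert_{W(L^p,l^q)}$ does not satisfy (P4). (2) Let $1\le p<q\le\infty$. Then the norm $\lVert\cdot\rVert_{W(L^p,l^q)}$ does not satisfy (P5). Consequently, for $p,q\in[1,\infty]$, the norm $\lVert\cdot\rVert_{W(L^p,l^q)}$ is a Banach function norm if and only if $1\le p=q\le\infty$, in which case it coincides with the classical Lebesgue norm $\lVert\cdot\rVert_p$.
   Context: $\lambda$ is Lebesgue measure on $[0,\infty)$; $M$ is the set of extended complex-valued $\lambda$-measurable functions on $[0,\infty)$ (identified when equal a.e.), $M_+$ the non-negative ones; $\mathbb N$ contains $0$. For $p,q\in[1,\infty]$ and $f\in M$, the Wiener norm is $\lVert f\rVert_{W(L^p,l^q)}=\big(\sum_{n=0}^\infty\lVert f\chi_{[n,n+1)}\rVert_{L^p}^q\big)^{1/q}$ if $q<\infty$ and $\lVert f\rVert_{W(L^p,l^\infty)}=\sup_{n\in\mathbb N}\lVert f\chi_{[n,n+1)}\rVert_{L^p}$. A Banach function norm is a map $\lVert\cdot\rVert:M\to[0,\infty]$ with $\lVert\,|f|\,\rVert=\lVert f\rVert$ whose restriction to $M_+$ satisfies: (P1) it is positively homogeneous, $\lVert f\rVert=0\Leftrightarrow f=0$ a.e., and $\lVert f+g\rVert\le\lVert f\rVert+\lVert g\rVert$; (P2) $f\le g$ a.e. implies $\lVert f\rVert\le\lVert g\rVert$; (P3) $f_n\uparrow f$ a.e. implies $\lVert f_n\rVert\uparrow\lVert f\rVert$; (P4)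 $\lVert\chi_E\rVert<\infty$ whenever $\lambda(E)<\infty$; (P5) for every $E$ with $\lambda(E)<\infty$ there is a finite $C_E$ with $\int_E f\,d\lambda\le C_E\lVert f\rVert$ for all $f\in M_+$. *)

theory Defs
  imports "HOL-Analysis.Analysis" "HOL-Probability.Essential_Supremum"
begin

abbreviation halfline :: "real measure"
  where "halfline \<equiv> lebesgue_on {0..}"

text \<open>Extended complex numbers: the complex plane with one infinite element added.  The
  nonnegative extended reals form the subset \<open>range ec_of_ennreal\<close>.\<close>

datatype ecomplex = ECfin complex | ECinf

definition ec_abs :: "ecomplex \<Rightarrow> ennreal"
  where "ec_abs z = (case z of ECfin w \<Rightarrow> ennreal (cmod w) | ECinf \<Rightarrow> top)"

definition ec_of_ennreal :: "ennreal \<Rightarrow> ecomplex"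
  where "ec_of_ennreal a = (if a = top then ECinf else ECfin (complex_of_real (enn2real a)))"

text \<open>The singleton \<open>{ECinf}\<close> is the complement of the generator \<open>range ECfin\<close>, so this is the
  Borel \<open>\<sigma>\<close>-algebra of the Riemann sphere.\<close>

definition ec_borel :: "ecomplex measure"
  where "ec_borel = sigma UNIV {ECfin ` U | U. open U}"

lemma ec_abs_ec_of_ennreal [simp]: "ec_abs (ec_of_ennreal a) = a"
  by (auto simp: ec_abs_def ec_of_ennreal_def ennreal_enn2real_if)

lemma inj_ec_of_ennreal: "inj ec_of_ennreal"
  by (metis ec_abs_ec_of_ennreal injI)

text \<open>The class \<open>M\<close>.  Its members are functions on the whole real line, but only their values on
  \<open>[0,\<infinity>)\<close> matter.\<close>

definition meas_funs :: "(real \<Rightarrow> ecomplex) set"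
  where "meas_funs = measurable halfline ec_borel"

text \<open>The class \<open>M\<^sub>+\<close> is represented by \<open>ennreal\<close>-valued functions; \<open>ec_fun\<close> is the inclusion of
  \<open>M\<^sub>+\<close> into \<open>M\<close> (see \<open>ec_fun_in_meas_funs_iff\<close> below).\<close>

definition nonneg_meas_funs :: "(real \<Rightarrow> ennreal) set"
  where "nonneg_meas_funs = borel_measurable halfline"

definition ec_fun :: "(real \<Rightarrow> ennreal) \<Rightarrow> real \<Rightarrow> ecomplex"
  where "ec_fun u = (\<lambda>x. ec_of_ennreal (u x))"

definition abs_fun :: "(real \<Rightarrow> ecomplex) \<Rightarrow> real \<Rightarrow> ennreal"
  where "abs_fun f = (\<lambda>x. ec_abs (f x))"

text \<open>The product \<open>f \<chi>\<^sub>E\<close>, with \<open>\<infinity> \<cdot> 0 = 0\<close>.\<close>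

definition cut :: "real set \<Rightarrow> (real \<Rightarrow> ecomplex) \<Rightarrow> real \<Rightarrow> ecomplex"
  where "cut E f = (\<lambda>x. if x \<in> E then f x else ECfin 0)"

text \<open>Powers of extended nonnegative reals; used only for \<open>r > 0\<close>, where \<open>0\<close> and \<open>\<infinity>\<close> are fixed.\<close>

definition enn_powr :: "ennreal \<Rightarrow> real \<Rightarrow> ennreal"
  where "enn_powr a r = (if a = top then top else ennreal (enn2real a powr r))"

definition Lp_norm :: "ennreal \<Rightarrow> (real \<Rightarrow> ecomplex) \<Rightarrow> ennreal"
  where "Lp_norm p f =
    (if p = top then esssup halfline (abs_fun f)
     else enn_powr (\<integral>\<^sup>+x. enn_powr (abs_fun f x) (enn2real p) \<partial>halfline) (1 / enn2real p))"

definition wiener_norm :: "ennreal \<Rightarrow> ennreal \<Rightarrow> (real \<Rightarrow> ecomplex) \<Rightarrow> ennreal"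
  where "wiener_norm p q f =
    (if q = top then (SUP n. Lp_norm p (cut {real n..<real n + 1} f))
     else enn_powr (\<Sum>n. enn_powr (Lp_norm p (cut {real n..<real n + 1} f)) (enn2real q))
            (1 / enn2real q))"

definition norm_P1 :: "((real \<Rightarrow> ecomplex) \<Rightarrow> ennreal) \<Rightarrow> bool"
  where "norm_P1 \<rho> \<longleftrightarrow>
    (\<forall>a\<ge>0. \<forall>f\<in>nonneg_meas_funs.
        \<rho> (ec_fun (\<lambda>x. ennreal a * f x)) = ennreal a * \<rho> (ec_fun f)) \<and>
    (\<forall>f\<in>nonneg_meas_funs. \<rho> (ec_fun f) = 0 \<longleftrightarrow> (AE x in halfline. f x = 0)) \<and>
    (\<forall>f\<in>nonneg_meas_funs. \<forall>g\<in>nonneg_meas_funs.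
        \<rho> (ec_fun (\<lambda>x. f x + g x)) \<le> \<rho> (ec_fun f) + \<rho> (ec_fun g))"

definition norm_P2 :: "((real \<Rightarrow> ecomplex) \<Rightarrow> ennreal) \<Rightarrow> bool"
  where "norm_P2 \<rho> \<longleftrightarrow>
    (\<forall>f\<in>nonneg_meas_funs. \<forall>g\<in>nonneg_meas_funs.
        (AE x in halfline. f x \<le> g x) \<longrightarrow> \<rho> (ec_fun f) \<le> \<rho> (ec_fun g))"

definition norm_P3 :: "((real \<Rightarrow> ecomplex) \<Rightarrow> ennreal) \<Rightarrow> bool"
  where "norm_P3 \<rho> \<longleftrightarrow>
    (\<forall>f\<in>nonneg_meas_funs. \<forall>F. (\<forall>n::nat. F n \<in> nonneg_meas_funs) \<longrightarrow>
        (AE x in halfline. incseq (\<lambda>n. F n x) \<and> (\<lambda>n. F n x) \<longlonglongrightarrow> f x) \<longrightarrow>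
        incseq (\<lambda>n. \<rho> (ec_fun (F n))) \<and> (\<lambda>n. \<rho> (ec_fun (F n))) \<longlonglongrightarrow> \<rho> (ec_fun f))"

definition norm_P4 :: "((real \<Rightarrow> ecomplex) \<Rightarrow> ennreal) \<Rightarrow> bool"
  where "norm_P4 \<rho> \<longleftrightarrow>
    (\<forall>E\<in>sets halfline. emeasure halfline E < top \<longrightarrow> \<rho> (ec_fun (indicator E)) < top)"

definition norm_P5 :: "((real \<Rightarrow> ecomplex) \<Rightarrow> ennreal) \<Rightarrow> bool"
  where "norm_P5 \<rho> \<longleftrightarrow>
    (\<forall>E\<in>sets halfline. emeasure halfline E < top \<longrightarrow>
        (\<exists>C<top. \<forall>f\<in>nonneg_meas_funs. (\<integral>\<^sup>+x\<in>E. f x \<partial>halfline) \<le> C * \<rho> (ec_fun f)))"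

text \<open>The first conjunct says that \<open>\<rho>\<close> is well defined on a.e.-equivalence classes.\<close>

definition banach_function_norm :: "((real \<Rightarrow> ecomplex) \<Rightarrow> ennreal) \<Rightarrow> bool"
  where "banach_function_norm \<rho> \<longleftrightarrow>
    (\<forall>f\<in>meas_funs. \<forall>g\<in>meas_funs. (AE x in halfline. f x = g x) \<longrightarrow> \<rho> f = \<rho> g) \<and>
    (\<forall>f\<in>meas_funs. \<rho> (ec_fun (abs_fun f)) = \<rho> f) \<and>
    norm_P1 \<rho> \<and> norm_P2 \<rho> \<and> norm_P3 \<rho> \<and> norm_P4 \<rho> \<and> norm_P5 \<rho>"

lemma space_ec_borel [simp]: "space ec_borel = UNIV"
  by (simp add: ec_borel_def)

lemma ECfin_image_in_ec_borel:
  assumes "open U" shows "ECfin ` U \<in> sets ec_borel"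
  using assms by (auto simp: ec_borel_def sets_measure_of)

lemma measurable_ec_abs [measurable]: "ec_abs \<in> borel_measurable ec_borel"
proof (rule borel_measurableI_greater)
  fix y :: ennreal
  have *: "ECfin ` {w. y < ennreal (cmod w)} \<in> sets ec_borel"
    by (intro ECfin_image_in_ec_borel open_Collect_less continuous_on_ennreal continuous_intros)
  have fin: "UNIV - range ECfin \<in> sets ec_borel"
    using sets.compl_sets[OF ECfin_image_in_ec_borel[OF open_UNIV]] by simp
  have "{x \<in> space ec_borel. y < ec_abs x} =
      ECfin ` {w. y < ennreal (cmod w)} \<union> (if y < top then UNIV - range ECfin else {})"
    (is "?L = ?R")
  proof (rule set_eqI)
    fix z show "z \<in> ?L \<longleftrightarrow> z \<in> ?R"
      by (cases z) (auto simp: ec_abs_def)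
  qed
  then show "{x \<in> space ec_borel. y < ec_abs x} \<in> sets ec_borel"
    using * fin by auto
qed

lemma measurable_ec_of_ennreal [measurable]: "ec_of_ennreal \<in> measurable borel ec_borel"
  unfolding ec_borel_def
proof (rule measurable_measure_of)
  fix A assume "A \<in> {ECfin ` U |U. open U}"
  then obtain U where A: "A = ECfin ` U" "open U" by auto
  have g: "(\<lambda>a. complex_of_real (enn2real a)) \<in> borel_measurable borel"
    by measurable
  have "ec_of_ennreal -` A \<inter> space borel =
      ((\<lambda>a. complex_of_real (enn2real a)) -` U \<inter> space borel) - {top}"
    by (auto simp: A ec_of_ennreal_def split: if_splits)
  also have "\<dots> \<in> sets borel"
    using measurable_sets[OF g borel_open[OF A(2)]] by (intro sets.Diff) auto
  finally show "ec_of_ennreal -` A \<inter> space borel \<in> sets borel" .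
qed auto

lemma ec_fun_in_meas_funs_iff: "ec_fun u \<in> meas_funs \<longleftrightarrow> u \<in> nonneg_meas_funs"
proof
  assume "ec_fun u \<in> meas_funs"
  then have "(\<lambda>x. ec_abs (ec_fun u x)) \<in> borel_measurable halfline"
    unfolding meas_funs_def by measurable
  then show "u \<in> nonneg_meas_funs"
    by (simp add: ec_fun_def nonneg_meas_funs_def)
qed (auto simp: ec_fun_def nonneg_meas_funs_def meas_funs_def)

lemma abs_fun_in_nonneg_meas_funs: "f \<in> meas_funs \<Longrightarrow> abs_fun f \<in> nonneg_meas_funs"
  unfolding meas_funs_def nonneg_meas_funs_def abs_fun_def by measurable

end

(* When p = q, summing over the unit intervals turns the Wiener norm into the L^p norm, so (P1)-(P5)
   have to be checked for the latter only; the triangle inequality and (P5) follow from pointwise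
   convexity estimates after rescaling by a real number slightly above the norm.

   When p and q differ, the test functions are u = sum_n c_n chi_[n, n + a_n), where the a_n <= 1 have
   a finite sum: the Wiener norm of u is the l^q norm of c_n a_n^(1/p) and its integral is the sum of
   the c_n a_n.  For q < p the choice c_n = 1, a_n = (n+1)^(-p/q) makes the norm of the indicator of a
   set of finite measure a divergent harmonic series.  For p < q the powers are balanced so that
   c_n a_n^(1/p) is in l^q although the sum of the c_n a_n diverges. *)

theory Submission
  imports Defs
begin

section \<open>Powers of extended nonnegative reals\<close>

lemma enn_powr_top [simp]: "enn_powr top r = top"
  by (simp add: enn_powr_def)

lemma enn_powr_ennreal: "0 \<le> a \<Longrightarrow> enn_powr (ennreal a) r = ennreal (a powr r)"
  by (simp add: enn_powr_def)

lemma enn_powr_0 [simp]: "enn_powr 0 r = 0"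
  by (simp add: enn_powr_def)

lemma enn_powr_1 [simp]: "enn_powr 1 r = 1"
  by (simp add: enn_powr_def)

lemma enn_powr_eq_top_iff [simp]: "enn_powr a r = top \<longleftrightarrow> a = top"
  by (simp add: enn_powr_def)

lemma enn_powr_eq_0_iff [simp]: "enn_powr a r = 0 \<longleftrightarrow> a = 0"
  by (cases a) (auto simp: enn_powr_ennreal ennreal_eq_0_iff)

lemma enn_powr_mono: "0 < r \<Longrightarrow> a \<le> b \<Longrightarrow> enn_powr a r \<le> enn_powr b r"
  by (cases a; cases b) (auto simp: enn_powr_ennreal powr_mono2 top_unique intro!: ennreal_leI)

lemma enn_powr_inverse [simp]:
  assumes "0 < r"
  shows "enn_powr (enn_powr a r) (1 / r) = a" and "enn_powr (enn_powr a (1 / r)) r = a"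
  using assms by (cases a; simp add: enn_powr_ennreal powr_powr)+

text \<open>Taking roots is adjoint to taking powers, also at \<open>0\<close> and
  \<open>top\<close>. Bounds on a norm thereby become bounds on an integral, with no roots
  left.\<close>

lemma enn_powr_le_iff:
  assumes "0 < r"
  shows "enn_powr a (1 / r) \<le> b \<longleftrightarrow> a \<le> enn_powr b r"
  using enn_powr_mono[of r "enn_powr a (1 / r)" b] enn_powr_mono[of "1 / r" a "enn_powr b r"] assms
  by auto

lemma enn_powr_mult:
  assumes "0 < r"
  shows "enn_powr (a * b) r = enn_powr a r * enn_powr b r"
\<comment> \<open>Zero is split off first because \<open>0 * top = 0\<close>; for nonzero factors an
  infinite one makes both sides \<open>top\<close>.\<close>
proof (cases "a = 0 \<or> b = 0")
  case False
  show ?thesis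
  proof (cases "a = top \<or> b = top")
    case True
    then show ?thesis
      using False by (auto simp: ennreal_top_mult ennreal_mult_top)
  next
    case False
    then show ?thesis
      by (cases a; cases b)
        (auto simp: enn_powr_ennreal powr_mult simp flip: ennreal_mult)
  qed
qed auto

lemma enn_powr_indicator: "enn_powr (a * indicator A x) r = enn_powr a r * indicator A x"
  by (simp add: indicator_def)

text \<open>By \<open>enn_powr_le_iff\<close> the root is a left adjoint, hence preserves arbitrary
  suprema; no continuity argument is required.\<close>

lemma enn_powr_SUP:
  assumes "0 < r"
  shows "enn_powr (SUP i\<in>I. F i) (1 / r) = (SUP i\<in>I. enn_powr (F i) (1 / r))"
proof (rule antisym)
  show "enn_powr (SUP i\<in>I. F i) (1 / r) \<le> (SUP i\<in>I. enn_powr (F i) (1 / r))"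
    unfolding enn_powr_le_iff[OF assms]
    by (rule SUP_least, subst enn_powr_le_iff[OF assms, symmetric], rule SUP_upper)
  show "(SUP i\<in>I. enn_powr (F i) (1 / r)) \<le> enn_powr (SUP i\<in>I. F i) (1 / r)"
    using assms by (intro SUP_least enn_powr_mono SUP_upper) auto
qed

lemma measurable_enn_powr [measurable]: "(\<lambda>a. enn_powr a r) \<in> borel_measurable borel"
  unfolding enn_powr_def by measurable

text \<open>Lets a norm \<open>y\<close>, possibly \<open>0\<close>, be replaced by a positive real
  \<open>s\<close> above it, by which one can divide. If \<open>y = top\<close>, the right side is
  \<open>top\<close> because \<open>c\<close> is nonzero.\<close>

lemma le_mult_of_le_mult_greater:
  fixes x y c :: ennreal
  assumes "c \<noteq> 0" "c < top" and le: "\<And>s. 0 < s \<Longrightarrow> y < ennreal s \<Longrightarrow> x \<le> c * ennreal s"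
  shows "x \<le> c * y"
proof (cases "y = top")
  case True
  then show ?thesis using \<open>c \<noteq> 0\<close> by (simp add: ennreal_mult_top)
next
  case False
  obtain c' where c: "c = ennreal c'" "0 \<le> c'" using assms(2) by (cases c) auto
  obtain y' where y: "y = ennreal y'" "0 \<le> y'" using False by (cases y) auto
  show ?thesis
  proof (rule ennreal_le_epsilon)
    fix e :: real assume e: "0 < e"
    \<comment> \<open>The excess is chosen so that multiplication by \<open>c'\<close> costs at most
      \<open>e\<close>.\<close>
    define s where "s = y' + e / (c' + 1)"
    have "0 < e / (c' + 1)" using c e by (intro divide_pos_pos) auto
    then have s: "0 < s" "y' < s" using y by (auto simp: s_def)
    have "c' * (e / (c' + 1)) \<le> e" using c e by (simp add: field_simps)
    then have "c' * s \<le> c' * y' + e" by (simp add: s_def distrib_left)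
    have "x \<le> c * ennreal s"
      using le[of s] s y by (simp add: ennreal_less_iff)
    also have "\<dots> \<le> c * y + ennreal e"
      using c y e s \<open>c' * s \<le> c' * y' + e\<close>
      by (simp flip: ennreal_mult ennreal_plus add: ennreal_leI)
    finally show "x \<le> c * y + ennreal e" .
  qed
qed

section \<open>The Lebesgue norms\<close>

lemma abs_fun_ec_fun [simp]: "abs_fun (ec_fun u) = u"
  by (simp add: abs_fun_def ec_fun_def)

lemma abs_fun_cut: "abs_fun (cut E f) = (\<lambda>x. abs_fun f x * indicator E x)"
  by (auto simp: abs_fun_def cut_def ec_abs_def indicator_def fun_eq_iff split: if_splits)

lemma one_le_finite_exponent:
  assumes "1 \<le> p" "p \<noteq> (top :: ennreal)"
  shows "1 \<le> enn2real p"
  using assms by (cases p) auto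

lemma Lp_norm_finite_le_iff:
  assumes "1 \<le> p" "p \<noteq> top"
  shows "Lp_norm p f \<le> a \<longleftrightarrow>
    (\<integral>\<^sup>+x. enn_powr (abs_fun f x) (enn2real p) \<partial>halfline) \<le> enn_powr a (enn2real p)"
  using one_le_finite_exponent[OF assms] assms(2) by (simp add: Lp_norm_def enn_powr_le_iff)

text \<open>For \<open>p = top\<close>, norms are handled only through their upper bounds: equal
  norms are those with the same a.e. bounds.\<close>

lemma esssup_le_iff:
  fixes a :: ennreal
  assumes "f \<in> borel_measurable M"
  shows "esssup M f \<le> a \<longleftrightarrow> (AE x in M. f x \<le> a)"
proof
  assume "esssup M f \<le> a"
  then show "AE x in M. f x \<le> a"
    using esssup_AE[of f M] by (auto elim: order_trans)
qed (use assms esssup_I in blast)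

lemma Lp_norm_top_le_iff:
  assumes "u \<in> nonneg_meas_funs"
  shows "Lp_norm top (ec_fun u) \<le> a \<longleftrightarrow> (AE x in halfline. u x \<le> a)"
  using assms by (simp add: Lp_norm_def esssup_le_iff nonneg_meas_funs_def)

lemma Lp_norm_mono:
  assumes "1 \<le> p" "u \<in> nonneg_meas_funs" "v \<in> nonneg_meas_funs"
    and le: "AE x in halfline. u x \<le> v x"
  shows "Lp_norm p (ec_fun u) \<le> Lp_norm p (ec_fun v)"
proof (cases "p = top")
  case True
  have "AE x in halfline. v x \<le> Lp_norm p (ec_fun v)"
    using Lp_norm_top_le_iff[OF assms(3)] True by blast
  with le have "AE x in halfline. u x \<le> Lp_norm p (ec_fun v)"
    by eventually_elim auto
  then show ?thesis
    using Lp_norm_top_le_iff[OF assms(2)] True by blast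
next
  case False
  have r: "0 < enn2real p" using one_le_finite_exponent[OF assms(1) False] by simp
  have "(\<integral>\<^sup>+x. enn_powr (u x) (enn2real p) \<partial>halfline)
      \<le> (\<integral>\<^sup>+x. enn_powr (v x) (enn2real p) \<partial>halfline)"
    using le by (intro nn_integral_mono_AE) (auto intro: enn_powr_mono[OF r])
  then show ?thesis
    using False r by (simp add: Lp_norm_def enn_powr_mono)
qed

lemma Lp_norm_cong_AE:
  assumes "1 \<le> p" "u \<in> nonneg_meas_funs" "v \<in> nonneg_meas_funs"
    and "AE x in halfline. u x = v x"
  shows "Lp_norm p (ec_fun u) = Lp_norm p (ec_fun v)"
  using assms by (intro antisym Lp_norm_mono) auto

lemma Lp_norm_eq_0_iff:
  assumes "1 \<le> p" "u \<in> nonneg_meas_funs"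
  shows "Lp_norm p (ec_fun u) = 0 \<longleftrightarrow> (AE x in halfline. u x = 0)"
proof (cases "p = top")
  case True
  then show ?thesis
    using Lp_norm_top_le_iff[OF assms(2), of 0] by simp
next
  case False
  have [measurable]: "u \<in> borel_measurable halfline"
    using assms(2) by (simp add: nonneg_meas_funs_def)
  show ?thesis
    using Lp_norm_finite_le_iff[OF assms(1) False, of "ec_fun u" 0]
    by (simp add: nn_integral_0_iff_AE)
qed

lemma Lp_norm_cmult:
  assumes "1 \<le> p" "u \<in> nonneg_meas_funs"
  shows "Lp_norm p (ec_fun (\<lambda>x. ennreal a * u x)) = ennreal a * Lp_norm p (ec_fun u)"
proof (cases "p = top")
  case True
  have [measurable]: "u \<in> borel_measurable halfline"
    using assms(2) by (simp add: nonneg_meas_funs_def)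
  show ?thesis
  proof (cases "a \<le> 0")
    case a: True
    then show ?thesis
      using Lp_norm_eq_0_iff[of p "\<lambda>x. 0"] assms
      by (simp add: ennreal_neg nonneg_meas_funs_def)
  next
    case False
    \<comment> \<open>Multiplication by a positive real is an order isomorphism of [0, infinity], so
      both norms in the claim have the same upper bounds.\<close>
    have scale: "ennreal a * y \<le> z \<longleftrightarrow> y \<le> ennreal (1 / a) * z" for y z
    proof -
      have inv: "ennreal (1 / a) * ennreal a = 1" "ennreal a * ennreal (1 / a) = 1"
        using False by (simp_all flip: ennreal_mult)
      show ?thesis
      proof
        assume "ennreal a * y \<le> z"
        then have "ennreal (1 / a) * (ennreal a * y) \<le> ennreal (1 / a) * z"
          by (intro mult_left_mono) auto
        then show "y \<le> ennreal (1 / a) * z" by (simp add: inv flip: mult.assoc)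
      next
        assume "y \<le> ennreal (1 / a) * z"
        then have "ennreal a * y \<le> ennreal a * (ennreal (1 / a) * z)"
          by (intro mult_left_mono) auto
        then show "ennreal a * y \<le> z" by (simp add: inv flip: mult.assoc)
      qed
    qed
    have "Lp_norm p (ec_fun (\<lambda>x. ennreal a * u x)) \<le> z \<longleftrightarrow>
        ennreal a * Lp_norm p (ec_fun u) \<le> z" for z
      using True assms(2)
      by (simp add: Lp_norm_top_le_iff scale nonneg_meas_funs_def)
    then show ?thesis by (metis antisym order_refl)
  qed
next
  case False
  have r: "0 < enn2real p" using one_le_finite_exponent[OF assms(1) False] by simp
  have [measurable]: "u \<in> borel_measurable halfline"
    using assms(2) by (simp add: nonneg_meas_funs_def)
  show ?thesis
    using False r by (simp add: Lp_norm_def enn_powr_mult nn_integral_cmult)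
qed

section \<open>Convexity of powers and Minkowski's inequality\<close>

text \<open>Convexity on the open half line extends to the endpoint 0, since
  \<open>t powr r \<le> t\<close> for \<open>t\<close> in (0,1).\<close>

lemma convex_on_powr_atLeast:
  fixes r :: real
  assumes "1 \<le> r"
  shows "convex_on {0..} (\<lambda>x. x powr r)"
proof (rule convex_onI)
  fix t x y :: real
  assume t: "0 < t" "t < 1" and xy: "x \<in> {0..}" "y \<in> {0..}"
  have le: "t powr r \<le> t" "(1 - t) powr r \<le> 1 - t"
    using powr_mono'[of 1 r t] powr_mono'[of 1 r "1 - t"] t assms by auto
  show "((1 - t) *\<^sub>R x + t *\<^sub>R y) powr r \<le> (1 - t) * x powr r + t * y powr r"
  proof (cases "x = 0 \<or> y = 0")
    case True
    then show ?thesis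
      using t xy le by (auto simp: powr_mult intro!: mult_right_mono)
  next
    case False
    then show ?thesis
      using convex_onD[OF powr_convex[OF assms], of t x y] t xy by simp
  qed
qed (rule convex_real_interval)

text \<open>Convexity at the points \<open>x / s\<close> and \<open>y / t\<close>, whose combination
  with weights \<open>s / (s + t)\<close> and \<open>t / (s + t)\<close> is
  \<open>(x + y) / (s + t)\<close>. For \<open>s\<close> and \<open>t\<close> above the norms of two
  functions, this is the pointwise form of Minkowski's inequality.\<close>

lemma powr_convex_combination:
  fixes r x y s t :: real
  assumes "1 \<le> r" "0 \<le> x" "0 \<le> y" "0 < s" "0 < t"
  shows "(x + y) powr r \<le>
    (s + t) powr r * (s / (s + t) * (x / s) powr r + t / (s + t) * (y / t) powr r)"
proof -
  have "(s / (s + t) * (x / s) + t / (s + t) * (y / t)) powr r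
      \<le> s / (s + t) * (x / s) powr r + t / (s + t) * (y / t) powr r"
  proof -
    have "(u * a + v * b) powr r \<le> u * a powr r + v * b powr r"
      if "0 \<le> a" "0 \<le> b" "0 \<le> u" "0 \<le> v" "u + v = 1" for a b u v
      using convex_on_powr_atLeast[OF assms(1)] that by (auto simp: convex_on_def)
    from this[of "x / s" "y / t" "s / (s + t)" "t / (s + t)"] show ?thesis
      using assms by (auto simp flip: add_divide_distrib simp del: times_divide_eq_left times_divide_eq_right)
  qed
  moreover have "s / (s + t) * (x / s) + t / (s + t) * (y / t) = (x + y) / (s + t)"
    using assms by (simp add: add_divide_distrib)
  ultimately have "((x + y) / (s + t)) powr r \<le>
      s / (s + t) * (x / s) powr r + t / (s + t) * (y / t) powr r" by simp
  moreover have "(x + y) powr r = (s + t) powr r * ((x + y) / (s + t)) powr r"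
    using assms by (simp add: powr_divide)
  ultimately show ?thesis
    by (simp add: mult_left_mono del: times_divide_eq_left times_divide_eq_right)
qed

lemma enn_powr_convex_combination:
  assumes "1 \<le> r" "0 < s" "0 < t"
  shows "enn_powr (a + b) r \<le>
    ennreal ((s + t) powr r * (s / (s + t)) / s powr r) * enn_powr a r +
    ennreal ((s + t) powr r * (t / (s + t)) / t powr r) * enn_powr b r"
proof (cases "a = top \<or> b = top")
  case True
  define \<alpha> \<beta> where "\<alpha> = (s + t) powr r * (s / (s + t)) / s powr r"
    and "\<beta> = (s + t) powr r * (t / (s + t)) / t powr r"
  \<comment> \<open>Positive coefficients make the right side infinite as soon as \<open>a\<close>
    or \<open>b\<close> is.\<close>
  have "0 < \<alpha>" "0 < \<beta>"
    unfolding \<alpha>_def \<beta>_def using assms by (auto intro!: mult_pos_pos divide_pos_pos)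
  then show ?thesis
    using True unfolding \<alpha>_def[symmetric] \<beta>_def[symmetric]
    by (auto simp: ennreal_mult_top ennreal_eq_0_iff)
next
  case False
  then obtain x y where a: "a = ennreal x" "0 \<le> x" and b: "b = ennreal y" "0 \<le> y"
    by (metis ennreal_cases)
  have "(x + y) powr r \<le> (s + t) powr r * (s / (s + t)) / s powr r * x powr r +
      (s + t) powr r * (t / (s + t)) / t powr r * y powr r"
    using powr_convex_combination[of r x y s t] assms a b
    by (simp add: powr_divide algebra_simps)
  then show ?thesis
    using assms a b
    by (simp add: enn_powr_ennreal flip: ennreal_plus ennreal_mult)
qed

lemma Lp_norm_triangle:
  assumes "1 \<le> p" "u \<in> nonneg_meas_funs" "v \<in> nonneg_meas_funs"
  shows "Lp_norm p (ec_fun (\<lambda>x. u x + v x)) \<le> Lp_norm p (ec_fun u) + Lp_norm p (ec_fun v)"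
proof (cases "p = top")
  case True
  have "AE x in halfline. u x \<le> Lp_norm p (ec_fun u)" "AE x in halfline. v x \<le> Lp_norm p (ec_fun v)"
    using Lp_norm_top_le_iff[OF assms(2)] Lp_norm_top_le_iff[OF assms(3)] True by blast+
  then have "AE x in halfline. u x + v x \<le> Lp_norm p (ec_fun u) + Lp_norm p (ec_fun v)"
    by eventually_elim (auto intro: add_mono)
  then show ?thesis
    using Lp_norm_top_le_iff[of "\<lambda>x. u x + v x"] True assms by (simp add: nonneg_meas_funs_def)
next
  case False
  define r where "r = enn2real p"
  have r: "1 \<le> r" unfolding r_def using one_le_finite_exponent[OF assms(1) False] .
  have [measurable]: "u \<in> borel_measurable halfline" "v \<in> borel_measurable halfline"
    using assms by (simp_all add: nonneg_meas_funs_def)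
  define I where "I w = (\<integral>\<^sup>+x. enn_powr (w x) r \<partial>halfline)" for w
  have le_iff: "Lp_norm p (ec_fun w) \<le> a \<longleftrightarrow> I w \<le> enn_powr a r" for w a
    using Lp_norm_finite_le_iff[OF assms(1) False] by (simp add: r_def I_def)
  show ?thesis
  proof (cases "Lp_norm p (ec_fun u) = top \<or> Lp_norm p (ec_fun v) = top")
    case False
    show ?thesis
    proof (rule ennreal_le_epsilon)
      fix e :: real assume "0 < e"
      obtain s' t' where s': "Lp_norm p (ec_fun u) = ennreal s'" "0 \<le> s'"
        and t': "Lp_norm p (ec_fun v) = ennreal t'" "0 \<le> t'"
        using False by (metis ennreal_cases)
      \<comment> \<open>The halves of \<open>e\<close> make \<open>s\<close> and \<open>t\<close>
        positive even for norms equal to zero, and add up to the allowed error.\<close>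
      define s t where "s = s' + e / 2" and "t = t' + e / 2"
      have st: "0 < s" "0 < t" "s' \<le> s" "t' \<le> t"
        using s' t' \<open>0 < e\<close> by (auto simp: s_def t_def)
      have Iu: "I u \<le> ennreal (s powr r)" and Iv: "I v \<le> ennreal (t powr r)"
        using le_iff[of u "ennreal s"] le_iff[of v "ennreal t"] s' t' st
        by (auto simp: enn_powr_ennreal ennreal_leI)
      define \<alpha> \<beta> where "\<alpha> = (s + t) powr r * (s / (s + t)) / s powr r"
        and "\<beta> = (s + t) powr r * (t / (s + t)) / t powr r"
      have pos: "0 \<le> \<alpha>" "0 \<le> \<beta>" using st by (auto simp: \<alpha>_def \<beta>_def)
      have "I (\<lambda>x. u x + v x) \<le>
          (\<integral>\<^sup>+x. ennreal \<alpha> * enn_powr (u x) r + ennreal \<beta> * enn_powr (v x) r \<partial>halfline)"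
        unfolding I_def \<alpha>_def \<beta>_def
        by (intro nn_integral_mono enn_powr_convex_combination r st)
      also have "\<dots> = ennreal \<alpha> * I u + ennreal \<beta> * I v"
        by (simp add: I_def nn_integral_add nn_integral_cmult)
      also have "\<dots> \<le> ennreal \<alpha> * ennreal (s powr r) + ennreal \<beta> * ennreal (t powr r)"
        by (intro add_mono mult_left_mono Iu Iv) auto
      also have "\<dots> = ennreal (\<alpha> * s powr r + \<beta> * t powr r)"
        using pos by (simp flip: ennreal_mult)
      \<comment> \<open>The denominators in \<open>\<alpha>\<close> and \<open>\<beta>\<close>
        cancel against the bounds on the integrals, leaving the two convex weights.\<close>
      also have "\<alpha> * s powr r + \<beta> * t powr r = (s + t) powr r * (s / (s + t) + t / (s + t))"
        using st by (simp add: \<alpha>_def \<beta>_def distrib_left)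
      also have "s / (s + t) + t / (s + t) = 1"
        using st by (simp flip: add_divide_distrib)
      finally have "Lp_norm p (ec_fun (\<lambda>x. u x + v x)) \<le> ennreal (s + t)"
        using st by (simp add: le_iff enn_powr_ennreal del: ennreal_plus)
      also have "\<dots> = Lp_norm p (ec_fun u) + Lp_norm p (ec_fun v) + ennreal e"
        using s' t' \<open>0 < e\<close> by (simp add: s_def t_def flip: ennreal_plus)
      finally show "Lp_norm p (ec_fun (\<lambda>x. u x + v x)) \<le>
        Lp_norm p (ec_fun u) + Lp_norm p (ec_fun v) + ennreal e" .
    qed
  qed auto
qed

text \<open>For \<open>p = top\<close>, countably many exceptional null sets are merged into one.
  For finite \<open>p\<close>, monotone convergence applies to the powers, and the root commutes
  with the supremum.\<close>

lemma Lp_norm_monotone_convergence: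
  assumes "1 \<le> p" "u \<in> nonneg_meas_funs" "\<And>n. F n \<in> nonneg_meas_funs"
    and conv: "AE x in halfline. incseq (\<lambda>n. F n x) \<and> (\<lambda>n. F n x) \<longlonglongrightarrow> u x"
  shows "incseq (\<lambda>n. Lp_norm p (ec_fun (F n)))"
    and "(\<lambda>n. Lp_norm p (ec_fun (F n))) \<longlonglongrightarrow> Lp_norm p (ec_fun u)"
proof -
  show inc: "incseq (\<lambda>n. Lp_norm p (ec_fun (F n)))"
  proof (rule monoI)
    fix m n :: nat assume "m \<le> n"
    have "AE x in halfline. F m x \<le> F n x"
      using conv by eventually_elim (use \<open>m \<le> n\<close> in \<open>auto dest: incseqD\<close>)
    then show "Lp_norm p (ec_fun (F m)) \<le> Lp_norm p (ec_fun (F n))"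
      by (intro Lp_norm_mono assms)
  qed
  have sup: "AE x in halfline. u x = (SUP n. F n x)"
    using conv by eventually_elim (metis LIMSEQ_SUP LIMSEQ_unique)
  have "Lp_norm p (ec_fun u) = (SUP n. Lp_norm p (ec_fun (F n)))"
  proof (cases "p = top")
    case True
    have "AE x in halfline. \<forall>n. F n x \<le> Lp_norm p (ec_fun (F n))"
      using Lp_norm_top_le_iff[OF assms(3)] True by (auto simp: AE_all_countable)
    with sup have "AE x in halfline. u x \<le> (SUP n. Lp_norm p (ec_fun (F n)))"
      by eventually_elim (auto intro!: SUP_mono)
    then have "Lp_norm p (ec_fun u) \<le> (SUP n. Lp_norm p (ec_fun (F n)))"
      using Lp_norm_top_le_iff[OF assms(2)] True by simp
    moreover have "Lp_norm p (ec_fun (F n)) \<le> Lp_norm p (ec_fun u)" for n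
    proof (intro Lp_norm_mono assms)
      show "AE x in halfline. F n x \<le> u x"
        using sup by eventually_elim (metis SUP_upper UNIV_I)
    qed
    ultimately show ?thesis by (intro antisym SUP_least)
  next
    case False
    define r where "r = enn2real p"
    have r: "0 < r" unfolding r_def using one_le_finite_exponent[OF assms(1) False] by simp
    have [measurable]: "F n \<in> borel_measurable halfline" for n
      using assms by (simp add: nonneg_meas_funs_def)
    have "(\<integral>\<^sup>+x. enn_powr (u x) r \<partial>halfline) = (\<integral>\<^sup>+x. (SUP n. enn_powr (F n x) r) \<partial>halfline)"
      \<comment> \<open>Instantiated at \<open>1 / r\<close>, the lemma on roots gives the exponent
        \<open>r\<close> itself.\<close>
      using sup enn_powr_SUP[of "1 / r"] r
      by (intro nn_integral_cong_AE) (auto elim!: eventually_mono)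
    also have "\<dots> = (SUP n. \<integral>\<^sup>+x. enn_powr (F n x) r \<partial>halfline)"
      using conv
      by (intro nn_integral_monotone_convergence_SUP_AE)
        (auto elim!: eventually_mono intro!: enn_powr_mono[OF r] simp: incseq_Suc_iff)
    finally show ?thesis
      using False r by (simp add: Lp_norm_def enn_powr_SUP flip: r_def)
  qed
  then show "(\<lambda>n. Lp_norm p (ec_fun (F n))) \<longlonglongrightarrow> Lp_norm p (ec_fun u)"
    using LIMSEQ_SUP[OF inc] by simp
qed

section \<open>(P4) and (P5) for the Lebesgue norms\<close>

lemma Lp_norm_indicator_finite:
  assumes "1 \<le> p" "E \<in> sets halfline" "emeasure halfline E < top"
  shows "Lp_norm p (ec_fun (indicator E)) < top"
proof (cases "p = top")
  case True
  have "Lp_norm p (ec_fun (indicator E)) \<le> 1"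
    using True assms(2) Lp_norm_top_le_iff[of "indicator E" 1]
    by (auto simp: nonneg_meas_funs_def indicator_def)
  then show ?thesis by (metis ennreal_one_less_top le_less_trans)
next
  case False
  then show ?thesis
    using enn_powr_indicator[of 1 E] assms by (simp add: Lp_norm_def flip: less_top)
qed

lemma le_one_plus_powr:
  fixes x r :: real
  assumes "1 \<le> r" "0 \<le> x"
  shows "x \<le> 1 + x powr r"
proof (cases "x \<le> 1")
  case True
  then show ?thesis by (simp add: add_increasing2)
next
  case False
  then have "x powr 1 \<le> x powr r" using assms by (intro powr_mono) auto
  then show ?thesis using False by simp
qed

text \<open>In place of Hoelder's inequality, \<open>le_one_plus_powr\<close> is applied to
  \<open>u x / s\<close> with \<open>s\<close> above the norm. The two terms contribute the measure
  of \<open>E\<close> and at most 1, so one constant serves every \<open>p\<close>.\<close>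

lemma set_nn_integral_le_Lp_norm:
  assumes "1 \<le> p" "E \<in> sets halfline" "emeasure halfline E < top" "u \<in> nonneg_meas_funs"
  shows "(\<integral>\<^sup>+x\<in>E. u x \<partial>halfline) \<le> (emeasure halfline E + 1) * Lp_norm p (ec_fun u)"
proof (cases "p = top")
  case True
  have "AE x in halfline. u x \<le> Lp_norm p (ec_fun u)"
    using Lp_norm_top_le_iff[OF assms(4)] True by blast
  then have "(\<integral>\<^sup>+x\<in>E. u x \<partial>halfline) \<le> (\<integral>\<^sup>+x\<in>E. Lp_norm p (ec_fun u) \<partial>halfline)"
    by (intro nn_integral_mono_AE) (auto elim!: eventually_mono intro: mult_right_mono)
  also have "\<dots> = emeasure halfline E * Lp_norm p (ec_fun u)"
    using assms(2) by (simp add: nn_integral_cmult_indicator) (simp add: mult.commute)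
  also have "\<dots> \<le> (emeasure halfline E + 1) * Lp_norm p (ec_fun u)"
    by (intro mult_right_mono) auto
  finally show ?thesis .
next
  case False
  define r where "r = enn2real p"
  have r: "1 \<le> r" unfolding r_def using one_le_finite_exponent[OF assms(1) False] .
  have [measurable]: "u \<in> borel_measurable halfline"
    using assms by (simp add: nonneg_meas_funs_def)
  note [measurable] = assms(2)
  show ?thesis
  proof (rule le_mult_of_le_mult_greater)
    show "emeasure halfline E + 1 \<noteq> 0" "emeasure halfline E + 1 < top" using assms by simp_all
    fix s :: real assume s: "0 < s" and less: "Lp_norm p (ec_fun u) < ennreal s"
    have I: "(\<integral>\<^sup>+x. enn_powr (u x) r \<partial>halfline) \<le> ennreal (s powr r)"
      using less_imp_le[OF less] s
      by (simp add: Lp_norm_finite_le_iff[OF assms(1) False] enn_powr_ennreal r_def)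
    have bound: "a \<le> ennreal s + ennreal (s / s powr r) * enn_powr a r" for a
    proof (cases a)
      case (real x)
      have "s * (x / s) \<le> s * (1 + (x / s) powr r)"
        using real s r by (intro mult_left_mono le_one_plus_powr) auto
      then have "x \<le> s + s / s powr r * x powr r"
        using real s by (simp add: powr_divide distrib_left)
      then show ?thesis
        using real s by (simp add: enn_powr_ennreal flip: ennreal_plus ennreal_mult)
    qed (use s in \<open>auto simp: ennreal_mult_top\<close>)
    \<comment> \<open>The indicator must stay on the constant, whose integral over the half line is
      infinite; the power may be integrated over the whole half line.\<close>
    have "(\<integral>\<^sup>+x\<in>E. u x \<partial>halfline) \<le>
        (\<integral>\<^sup>+x. ennreal s * indicator E x + ennreal (s / s powr r) * enn_powr (u x) r \<partial>halfline)"
      using bound by (intro nn_integral_mono) (auto simp: indicator_def)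
    also have "\<dots> = ennreal s * emeasure halfline E +
        ennreal (s / s powr r) * (\<integral>\<^sup>+x. enn_powr (u x) r \<partial>halfline)"
      by (simp add: nn_integral_add nn_integral_cmult nn_integral_cmult_indicator)
    also have "\<dots> \<le> ennreal s * emeasure halfline E + ennreal (s / s powr r) * ennreal (s powr r)"
      by (intro add_left_mono mult_left_mono I) auto
    also have "\<dots> = (emeasure halfline E + 1) * ennreal s"
      using s by (simp add: algebra_simps flip: ennreal_mult)
    finally show "(\<integral>\<^sup>+x\<in>E. u x \<partial>halfline) \<le> (emeasure halfline E + 1) * ennreal s" .
  qed
qed

lemma Lp_norm_ec_fun_abs_fun: "Lp_norm p (ec_fun (abs_fun f)) = Lp_norm p f"
  by (simp add: Lp_norm_def)

lemma banach_function_norm_Lp_norm: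
  assumes p: "1 \<le> p"
  shows "banach_function_norm (Lp_norm p)"
proof -
  have "Lp_norm p f = Lp_norm p g"
    if "f \<in> meas_funs" "g \<in> meas_funs" "AE x in halfline. f x = g x" for f g
  proof -
    have "AE x in halfline. abs_fun f x = abs_fun g x"
      using that(3) by eventually_elim (simp add: abs_fun_def)
    with that have "Lp_norm p (ec_fun (abs_fun f)) = Lp_norm p (ec_fun (abs_fun g))"
      by (intro Lp_norm_cong_AE p abs_fun_in_nonneg_meas_funs)
    then show ?thesis by (simp add: Lp_norm_ec_fun_abs_fun)
  qed
  moreover have "norm_P1 (Lp_norm p)"
    unfolding norm_P1_def by (simp add: Lp_norm_cmult Lp_norm_eq_0_iff Lp_norm_triangle p)
  moreover have "norm_P2 (Lp_norm p)"
    unfolding norm_P2_def using Lp_norm_mono[OF p] by blast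
  moreover have "norm_P3 (Lp_norm p)"
    unfolding norm_P3_def
    by (intro ballI allI impI conjI Lp_norm_monotone_convergence[OF p]) auto
  moreover have "norm_P4 (Lp_norm p)"
    unfolding norm_P4_def using Lp_norm_indicator_finite[OF p] by blast
  moreover have "norm_P5 (Lp_norm p)"
    unfolding norm_P5_def
  proof (intro ballI impI)
    fix E assume E: "E \<in> sets halfline" "emeasure halfline E < top"
    then show "\<exists>C<top. \<forall>f\<in>nonneg_meas_funs.
        (\<integral>\<^sup>+x\<in>E. f x \<partial>halfline) \<le> C * Lp_norm p (ec_fun f)"
      using set_nn_integral_le_Lp_norm[OF p E]
      by (intro exI[of _ "emeasure halfline E + 1"]) auto
  qed
  ultimately show ?thesis
    unfolding banach_function_norm_def using Lp_norm_ec_fun_abs_fun by blast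
qed

section \<open>The Wiener norms\<close>

text \<open>The unit intervals partition the half line. This is used both for summing over them and
  for separating the steps below.\<close>

lemma nat_unit_interval_iff: "0 \<le> x \<Longrightarrow> x \<in> {real n..<real n + 1} \<longleftrightarrow> n = nat \<lfloor>x\<rfloor>" for x :: real
  by (auto simp: nat_eq_iff2 floor_eq_iff)

lemma suminf_indicator_unit_intervals:
  assumes "0 \<le> x"
  shows "(\<Sum>n. indicator {real n..<real n + 1} x :: ennreal) = 1"
proof -
  have "(\<Sum>n. indicator {real n..<real n + 1} x :: ennreal) =
      (\<Sum>n\<in>{nat \<lfloor>x\<rfloor>}. indicator {real n..<real n + 1} x)"
    using nat_unit_interval_iff[OF assms] by (intro suminf_finite) (auto simp: indicator_def)
  then show ?thesis
    using nat_unit_interval_iff[OF assms, of "nat \<lfloor>x\<rfloor>"] by (simp add: indicator_def)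
qed

lemma unit_interval_in_sets [measurable]: "{real n..<a} \<in> sets halfline"
  by (auto simp: sets_restrict_space_iff)

text \<open>For finite \<open>p\<close> the outer power cancels the root on each interval, and sum
  and integral are interchanged. For \<open>p = top\<close> both norms have the same upper bounds,
  because there are only countably many intervals.\<close>

lemma wiener_norm_eq_Lp_norm:
  assumes p: "1 \<le> p" and f: "f \<in> meas_funs"
  shows "wiener_norm p p f = Lp_norm p f"
proof -
  define u where "u = abs_fun f"
  have [measurable]: "u \<in> borel_measurable halfline"
    using abs_fun_in_nonneg_meas_funs[OF f] by (simp add: u_def nonneg_meas_funs_def)
  show ?thesis
  proof (cases "p = top")
    case True
    have "wiener_norm p p f \<le> a \<longleftrightarrow> Lp_norm p f \<le> a" for a
    proof -
      have "wiener_norm p p f \<le> a \<longleftrightarrow>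
          (\<forall>n. AE x in halfline. u x * indicator {real n..<real n + 1} x \<le> a)"
        using True
        by (simp add: wiener_norm_def Lp_norm_def SUP_le_iff abs_fun_cut esssup_le_iff flip: u_def)
      also have "\<dots> \<longleftrightarrow>
          (AE x in halfline. \<forall>n. u x * indicator {real n..<real n + 1} x \<le> a)"
        by (simp add: AE_all_countable)
      also have "\<dots> \<longleftrightarrow> (AE x in halfline. u x \<le> a)"
      proof (rule AE_cong)
        fix x assume "x \<in> space halfline"
        then have "0 \<le> x" by (simp add: space_restrict_space)
        then show "(\<forall>n. u x * indicator {real n..<real n + 1} x \<le> a) \<longleftrightarrow> u x \<le> a"
          using nat_unit_interval_iff[of x] by (auto simp: indicator_def)
      qed
      also have "\<dots> \<longleftrightarrow> Lp_norm p f \<le> a"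
        using True by (simp add: Lp_norm_def esssup_le_iff flip: u_def)
      finally show ?thesis .
    qed
    then show ?thesis by (metis antisym order_refl)
  next
    case False
    define r where "r = enn2real p"
    have r: "0 < r" unfolding r_def using one_le_finite_exponent[OF p False] by simp
    have "(\<Sum>n. enn_powr (Lp_norm p (cut {real n..<real n + 1} f)) r) =
        (\<Sum>n. \<integral>\<^sup>+x. enn_powr (u x) r * indicator {real n..<real n + 1} x \<partial>halfline)"
      using False r
      by (simp add: Lp_norm_def abs_fun_cut enn_powr_indicator flip: r_def u_def)
    also have "\<dots> = (\<integral>\<^sup>+x. (\<Sum>n. enn_powr (u x) r * indicator {real n..<real n + 1} x) \<partial>halfline)"
      by (rule nn_integral_suminf[symmetric]) measurable
    also have "\<dots> = (\<integral>\<^sup>+x. enn_powr (u x) r \<partial>halfline)"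
      by (intro nn_integral_cong)
        (simp add: ennreal_suminf_cmult suminf_indicator_unit_intervals space_restrict_space)
    finally show ?thesis
      using False by (simp add: wiener_norm_def Lp_norm_def flip: r_def u_def)
  qed
qed

text \<open>Each axiom evaluates the norm at measurable functions only. This matters because
  \<open>wiener_norm_eq_Lp_norm\<close> is confined to \<open>meas_funs\<close>.\<close>

lemma banach_function_norm_cong:
  assumes "\<And>f. f \<in> meas_funs \<Longrightarrow> \<rho> f = \<sigma> f"
  shows "banach_function_norm \<rho> \<longleftrightarrow> banach_function_norm \<sigma>"
proof -
  have eq: "\<rho> (ec_fun u) = \<sigma> (ec_fun u)" if "u \<in> nonneg_meas_funs" for u
    using assms that by (simp add: ec_fun_in_meas_funs_iff)
  have closed: "(\<lambda>x. ennreal a * u x) \<in> nonneg_meas_funs" "(\<lambda>x. u x + v x) \<in> nonneg_meas_funs"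
    "E \<in> sets halfline \<Longrightarrow> indicator E \<in> nonneg_meas_funs"
    if "u \<in> nonneg_meas_funs" "v \<in> nonneg_meas_funs" for u v a E
    using that by (auto simp: nonneg_meas_funs_def)
  \<comment> \<open>Supplies the members \<open>u\<close> and \<open>v\<close> of the class that
    \<open>closed(3)\<close> asks for.\<close>
  have zero: "(\<lambda>x. 0) \<in> nonneg_meas_funs" by (simp add: nonneg_meas_funs_def)
  have "norm_P1 \<rho> \<longleftrightarrow> norm_P1 \<sigma>"
    by (simp add: norm_P1_def eq closed cong: ball_cong)
  moreover have "norm_P2 \<rho> \<longleftrightarrow> norm_P2 \<sigma>"
    by (simp add: norm_P2_def eq cong: ball_cong)
  moreover have "norm_P3 \<rho> \<longleftrightarrow> norm_P3 \<sigma>"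
    by (simp add: norm_P3_def eq cong: ball_cong)
  moreover have "norm_P4 \<rho> \<longleftrightarrow> norm_P4 \<sigma>"
    by (simp add: norm_P4_def eq closed(3)[OF zero zero] cong: ball_cong)
  moreover have "norm_P5 \<rho> \<longleftrightarrow> norm_P5 \<sigma>"
    by (simp add: norm_P5_def eq cong: ball_cong)
  ultimately show ?thesis
    by (simp add: banach_function_norm_def assms eq abs_fun_in_nonneg_meas_funs cong: ball_cong)
qed

section \<open>Step functions with one step in every unit interval\<close>

text \<open>Heights \<open>c\<close>, widths \<open>a\<close>. For widths at most 1 no two steps
  overlap; the series form permits termwise integration.\<close>

definition unit_steps :: "(nat \<Rightarrow> real) \<Rightarrow> (nat \<Rightarrow> real) \<Rightarrow> real \<Rightarrow> ennreal"
  where "unit_steps c a x = (\<Sum>n. ennreal (c n) * indicator {real n..<real n + a n} x)"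

lemma unit_steps_in_nonneg_meas_funs: "unit_steps c a \<in> nonneg_meas_funs"
  unfolding nonneg_meas_funs_def unit_steps_def by measurable

lemma emeasure_interval_halfline:
  assumes "0 \<le> a"
  shows "emeasure halfline {real n..<real n + a} = ennreal a"
  using assms by (subst emeasure_restrict_space) auto

lemma nn_integral_unit_steps:
  assumes "\<And>n. 0 \<le> a n"
  shows "(\<integral>\<^sup>+x. unit_steps c a x \<partial>halfline) = (\<Sum>n. ennreal (c n) * ennreal (a n))"
proof -
  have "(\<integral>\<^sup>+x. unit_steps c a x \<partial>halfline) =
      (\<Sum>n. \<integral>\<^sup>+x. ennreal (c n) * indicator {real n..<real n + a n} x \<partial>halfline)"
    unfolding unit_steps_def by (rule nn_integral_suminf) measurable
  then show ?thesis
    using assms by (simp add: nn_integral_cmult_indicator emeasure_interval_halfline)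
qed

text \<open>Since \<open>a m \<le> 1\<close>, every point of step \<open>m\<close> has integer part
  \<open>m\<close>, so only one summand survives on a unit interval.\<close>

lemma unit_steps_cut:
  assumes "\<And>n. a n \<le> 1"
  shows "unit_steps c a x * indicator {real n..<real n + 1} x =
    ennreal (c n) * indicator {real n..<real n + a n} x"
proof (cases "x \<in> {real n..<real n + 1}")
  case True
  have "x \<notin> {real m..<real m + a m}" if "m \<noteq> n" for m
    using nat_unit_interval_iff[of x m] nat_unit_interval_iff[of x n] True that assms[of m] by auto
  moreover define s where "s m = ennreal (c m) * indicator {real m..<real m + a m} x" for m
  ultimately have "(\<Sum>m. s m) = (\<Sum>m\<in>{n}. s m)"
    by (intro suminf_finite) auto
  then have "(\<Sum>m. s m) = s n" by simp
  then show ?thesis using True by (simp add: unit_steps_def s_def)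
next
  case False
  then show ?thesis using assms[of n] by (auto simp: indicator_def)
qed

lemma Lp_norm_step:
  assumes "1 \<le> p" "p \<noteq> top" "0 \<le> a" "0 \<le> c"
    and "abs_fun f = (\<lambda>x. ennreal c * indicator {real n..<real n + a} x)"
  shows "Lp_norm p f = ennreal (c * a powr (1 / enn2real p))"
proof -
  define r where "r = enn2real p"
  have r: "1 \<le> r" unfolding r_def by (rule one_le_finite_exponent) fact+
  have "(\<integral>\<^sup>+x. enn_powr (abs_fun f x) r \<partial>halfline) = ennreal (c powr r * a)"
    using assms(3,4)
    by (simp add: assms(5) enn_powr_indicator enn_powr_ennreal nn_integral_cmult_indicator
        emeasure_interval_halfline ennreal_mult)
  then show ?thesis
    using assms r by (simp add: Lp_norm_def enn_powr_ennreal powr_mult powr_powr flip: r_def)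
qed

text \<open>If the norm were smaller, the whole step would lie in the exceptional null set, but its
  length is positive.\<close>

lemma Lp_norm_top_step_ge:
  assumes "0 < a" "abs_fun f = (\<lambda>x. ennreal c * indicator {real n..<real n + a} x)"
  shows "ennreal c \<le> Lp_norm top f"
proof (rule ccontr)
  assume less: "\<not> ennreal c \<le> Lp_norm top f"
  have "AE x in halfline. abs_fun f x \<le> Lp_norm top f"
    by (simp add: Lp_norm_def esssup_AE)
  then have "AE x in halfline. x \<notin> {real n..<real n + a}"
    by eventually_elim (use less in \<open>auto simp: assms(2)\<close>)
  then have "{real n..<real n + a} \<in> null_sets halfline"
    using AE_iff_null_sets[of "{real n..<real n + a}" halfline] by simp
  then show False
    using emeasure_interval_halfline[of a n] assms(1) by (auto simp: null_sets_def)
qed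

lemma abs_fun_cut_unit_steps:
  assumes "\<And>n. a n \<le> 1"
  shows "abs_fun (cut {real n..<real n + 1} (ec_fun (unit_steps c a))) =
    (\<lambda>x. ennreal (c n) * indicator {real n..<real n + a n} x)"
  by (simp add: abs_fun_cut unit_steps_cut[OF assms] fun_eq_iff)

section \<open>Supports of step functions and their measure\<close>

definition step_support :: "(nat \<Rightarrow> real) \<Rightarrow> real set"
  where "step_support a = (\<Union>n. {real n..<real n + a n})"

lemma step_support_in_sets [measurable]: "step_support a \<in> sets halfline"
  unfolding step_support_def by measurable

lemma emeasure_step_support_finite:
  assumes "\<And>n. 0 \<le> a n" "summable a"
  shows "emeasure halfline (step_support a) < top"
proof -
  have "emeasure halfline (step_support a) \<le> (\<Sum>n. emeasure halfline {real n..<real n + a n})"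
    unfolding step_support_def by (rule emeasure_subadditive_countably) auto
  also have "\<dots> = (\<Sum>n. ennreal (a n))"
    using assms(1) by (simp add: emeasure_interval_halfline)
  also have "\<dots> < top"
    using ennreal_suminf_neq_top[OF assms(2,1)] by (simp add: less_top)
  finally show ?thesis .
qed

text \<open>(P5) concerns integrals over sets of finite measure; restricting to the support loses
  nothing of the integral.\<close>

lemma unit_steps_mult_indicator_support:
  "unit_steps c a x * indicator (step_support a) x = unit_steps c a x"
proof (cases "x \<in> step_support a")
  case False
  then have "\<And>n. x \<notin> {real n..<real n + a n}" by (auto simp: step_support_def)
  then have "unit_steps c a x = 0" by (simp add: unit_steps_def)
  then show ?thesis by simp
qed simp

text \<open>Makes the norm computations for step functions available for the sets that refute
  (P4).\<close>

lemma indicator_step_support: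
  assumes "\<And>n. a n \<le> 1"
  shows "indicator (step_support a) = unit_steps (\<lambda>_. 1) a"
proof
  fix x :: real
  have "disjoint_family (\<lambda>n. {real n..<real n + a n})"
  proof (unfold disjoint_family_on_def, safe)
    fix m n x assume "m \<noteq> n" "x \<in> {real m..<real m + a m}" "x \<in> {real n..<real n + a n}"
    then show "x \<in> {}"
      using assms[of m] assms[of n] nat_unit_interval_iff[of x m] nat_unit_interval_iff[of x n] by auto
  qed
  then show "indicator (step_support a) x = unit_steps (\<lambda>_. 1) a x"
    unfolding unit_steps_def step_support_def by (simp add: suminf_indicator)
qed

section \<open>Harmonic comparison and the failure of (P4) and (P5)\<close>

text \<open>The shift avoids the default value \<open>0 powr s = 0\<close> and does not affect
  summability.\<close>

lemma summable_Suc_powr_iff: "summable (\<lambda>n. real (Suc n) powr s) \<longleftrightarrow> s < - 1"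
  using summable_real_powr_iff[of s] summable_Suc_iff[of "\<lambda>n. real n powr s"] by simp

lemma Suc_powr_le_1: "s \<le> 0 \<Longrightarrow> real (Suc n) powr s \<le> 1"
  using powr_mono[of s 0 "real (Suc n)"] by simp

lemma suminf_harmonic_eq_top: "(\<Sum>n. ennreal (real (Suc n) powr - 1)) = top"
proof (rule ccontr)
  assume "\<not> ?thesis"
  then have "summable (\<lambda>n. real (Suc n) powr - 1)"
    by (intro summable_suminf_not_top) auto
  then show False
    unfolding summable_Suc_powr_iff by simp
qed

lemma finite_exponent_less:
  assumes "1 \<le> p" "p < q" "q \<noteq> (top :: ennreal)"
  shows "1 \<le> enn2real p" "enn2real p < enn2real q"
proof -
  have "p \<noteq> top" using assms by auto
  then show "1 \<le> enn2real p" using assms(1) by (rule one_le_finite_exponent[rotated])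
  show "enn2real p < enn2real q"
    using assms(2,3) \<open>p \<noteq> top\<close> by (simp add: enn2real_less_iff flip: less_top)
qed

lemma not_norm_P4_wiener_norm:
  assumes "1 \<le> q" "q < p"
  shows "\<not> norm_P4 (wiener_norm p q)"
proof
  assume P4: "norm_P4 (wiener_norm p q)"
  have q: "q \<noteq> top" using assms by auto
  define s where "s = enn2real q"
  have s: "1 \<le> s" unfolding s_def using one_le_finite_exponent[OF assms(1) q] .
  have p: "1 \<le> p" using assms by auto
  \<comment> \<open>For \<open>p = \<infinity>\<close> every step has norm \<open>1\<close>, so any summable sequence of positive lengths works.\<close>
  define \<alpha> where "\<alpha> = (if p = top then 2 else enn2real p / s)"
  have \<alpha>: "1 < \<alpha>"
    using finite_exponent_less(2)[OF assms] s by (simp add: \<alpha>_def s_def)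
  define a where "a n = real (Suc n) powr - \<alpha>" for n
  have pos: "0 < a n" and le1: "a n \<le> 1" for n
    unfolding a_def using \<alpha> by (auto intro: Suc_powr_le_1 simp del: of_nat_Suc)
  let ?E = "step_support a"
  have "summable a"
    unfolding a_def[abs_def] summable_Suc_powr_iff using \<alpha> by simp
  then have "emeasure halfline ?E < top"
    by (intro emeasure_step_support_finite less_imp_le[OF pos])
  then have "wiener_norm p q (ec_fun (indicator ?E)) < top"
    using P4 step_support_in_sets unfolding norm_P4_def by blast
  moreover have "wiener_norm p q (ec_fun (indicator ?E)) = top"
  proof -
    define F where "F n = Lp_norm p (cut {real n..<real n + 1} (ec_fun (indicator ?E)))" for n
    \<comment> \<open>For finite \<open>p\<close> this is an equality, as
      \<open>\<alpha> * s / enn2real p = 1\<close>. For \<open>p = top\<close> the left side is at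
      most 1 and each step has norm at least 1.\<close>
    have "ennreal (real (Suc n) powr - 1) \<le> enn_powr (F n) s" for n
    proof (cases "p = top")
      case True
      have "1 \<le> F n"
        using Lp_norm_top_step_ge[OF pos[of n] abs_fun_cut_unit_steps[of a, OF le1, of n "\<lambda>_. 1"]]
        by (simp add: F_def True indicator_step_support[OF le1])
      then have "1 \<le> enn_powr (F n) s"
        using enn_powr_mono[of s 1 "F n"] s by simp
      moreover have "real (Suc n) powr - 1 \<le> 1"
        by (intro Suc_powr_le_1) simp
      ultimately show ?thesis
        by (metis ennreal_1 ennreal_leI order_trans)
    next
      case False
      have "F n = ennreal (a n powr (1 / enn2real p))"
        using Lp_norm_step[OF p False less_imp_le[OF pos[of n]] zero_le_one
            abs_fun_cut_unit_steps[of a, OF le1, of n "\<lambda>_. 1"]]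
        by (simp add: F_def indicator_step_support[OF le1])
      moreover have "0 < enn2real p" using one_le_finite_exponent[OF p False] by simp
      ultimately show ?thesis
        using s by (simp add: enn_powr_ennreal a_def powr_powr \<alpha>_def False)
    qed
    then have "(\<Sum>n. ennreal (real (Suc n) powr - 1)) \<le> (\<Sum>n. enn_powr (F n) s)"
      by (intro suminf_le) auto
    then have "(\<Sum>n. enn_powr (F n) s) = top"
      by (simp only: suminf_harmonic_eq_top top_unique)
    then show ?thesis
      using q by (simp add: wiener_norm_def F_def s_def)
  qed
  ultimately show False by simp
qed

lemma not_norm_P5_wiener_norm:
  assumes "1 \<le> p" "p < q"
  shows "\<not> norm_P5 (wiener_norm p q)"
proof
  assume P5: "norm_P5 (wiener_norm p q)"
  have p: "p \<noteq> top" using assms by auto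
  define r where "r = enn2real p"
  have r: "1 \<le> r" unfolding r_def using one_le_finite_exponent[OF assms(1) p] .
  \<comment> \<open>This is 1/q with 1/infinity read as 0, so that \<open>p < q\<close> becomes
    \<open>t < 1 / r\<close> in all cases.\<close>
  define t where "t = (if q = top then 0 else 1 / enn2real q)"
  have t: "0 \<le> t" "t < 1 / r"
    using finite_exponent_less[OF assms] r by (auto simp: t_def r_def frac_less2)
  \<comment> \<open>Lengths \<open>(n+1) powr -(1+d)\<close> and \<open>L\<^sup>p\<close> norms \<open>(n+1) powr -(t+d)\<close> of the steps are both just
    summable (the latter in \<open>l\<^sup>q\<close>), while the integrals of the steps are
    \<open>(n+1) powr (d / r - 1)\<close>.\<close>
  define d where "d = (1 / r - t) / 2"
  have d: "0 < d" using t by (simp add: d_def)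
  define a where "a n = real (Suc n) powr - (1 + d)" for n
  \<comment> \<open>The summand \<open>(1 + d) / r\<close> compensates the factor
    \<open>a n powr (1 / r)\<close> in the norm of a step.\<close>
  define c where "c n = real (Suc n) powr ((1 + d) / r - (t + d))" for n
  have pos: "0 \<le> a n" "0 \<le> c n" and le1: "a n \<le> 1" for n
    unfolding a_def c_def using d by (auto intro: Suc_powr_le_1 simp del: of_nat_Suc)
  let ?E = "step_support a" and ?u = "unit_steps c a"
  have "summable a"
    unfolding a_def[abs_def] summable_Suc_powr_iff using d by simp
  then have "emeasure halfline ?E < top"
    by (intro emeasure_step_support_finite pos)
  then obtain C where C: "C < top"
    "(\<integral>\<^sup>+x\<in>?E. ?u x \<partial>halfline) \<le> C * wiener_norm p q (ec_fun ?u)"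
    using P5 step_support_in_sets unit_steps_in_nonneg_meas_funs unfolding norm_P5_def by blast
  have "(\<integral>\<^sup>+x\<in>?E. ?u x \<partial>halfline) = (\<Sum>n. ennreal (c n * a n))"
    using pos by (simp add: unit_steps_mult_indicator_support nn_integral_unit_steps ennreal_mult)
  moreover have "(\<Sum>n. ennreal (real (Suc n) powr - 1)) \<le> (\<Sum>n. ennreal (c n * a n))"
  proof (intro suminf_le ennreal_leI)
    fix n
    \<comment> \<open>In the exponent of \<open>c n * a n\<close> the terms \<open>1 / r - t\<close>
      and \<open>2 * d\<close> cancel; what remains is \<open>d / r - 1\<close>, at least the
      harmonic exponent.\<close>
    have "0 \<le> d / r" using r d by simp
    moreover have "2 * d = 1 / r - t" by (simp add: d_def)
    moreover have "(1 + d) / r = 1 / r + d / r" by (rule add_divide_distrib)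
    ultimately have "- 1 \<le> (1 + d) / r - (t + d) + - (1 + d)" by linarith
    then have "real (Suc n) powr - 1 \<le> real (Suc n) powr ((1 + d) / r - (t + d) + - (1 + d))"
      by (intro powr_mono) auto
    also have "\<dots> = c n * a n"
      unfolding a_def c_def by (rule powr_add)
    finally show "real (Suc n) powr - 1 \<le> c n * a n" .
  qed auto
  ultimately have "(\<integral>\<^sup>+x\<in>?E. ?u x \<partial>halfline) = top"
    by (simp only: suminf_harmonic_eq_top top_unique)
  moreover have "wiener_norm p q (ec_fun ?u) < top"
  proof -
    have norm: "Lp_norm p (cut {real n..<real n + 1} (ec_fun ?u)) =
        ennreal (real (Suc n) powr - (t + d))" for n
    proof -
      have "(1 + d) / r - (t + d) + - (1 + d) * (1 / r) = - (t + d)"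
        by (simp add: add_divide_distrib diff_divide_distrib)
      then have "c n * a n powr (1 / r) = real (Suc n) powr - (t + d)"
        unfolding a_def c_def powr_powr powr_add[symmetric] by (rule arg_cong)
      then show ?thesis
        using Lp_norm_step[OF assms(1) p pos[of n] abs_fun_cut_unit_steps[of a, OF le1, of n c]]
        by (simp add: r_def)
    qed
    show ?thesis
    proof (cases "q = top")
      case True
      have "real (Suc n) powr - (t + d) \<le> 1" for n
        using t d by (intro Suc_powr_le_1) simp
      then have "wiener_norm p q (ec_fun ?u) \<le> 1"
        using True by (simp only: wiener_norm_def norm if_True) (auto intro!: SUP_least)
      then show ?thesis by (metis ennreal_one_less_top le_less_trans)
    next
      case False
      define s where "s = enn2real q"
      have s: "0 < s" using finite_exponent_less[OF assms False] by (simp add: s_def)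
      \<comment> \<open>Here \<open>t * s = 1\<close>, so the positive term \<open>d * s\<close> is
        what gives summability.\<close>
      have "1 < (t + d) * s" using s d False by (simp add: t_def s_def distrib_right)
      then have "summable (\<lambda>n. real (Suc n) powr (- (t + d) * s))"
        by (subst summable_Suc_powr_iff) (simp add: algebra_simps)
      then have "(\<Sum>n. ennreal (real (Suc n) powr (- (t + d) * s))) \<noteq> top"
        by (rule ennreal_suminf_neq_top) simp
      then show ?thesis
        using False by (simp add: wiener_norm_def norm enn_powr_ennreal powr_powr less_top[symmetric] flip: s_def)
    qed
  qed
  ultimately show False
    using C by (auto simp: top_unique ennreal_mult_eq_top_iff)
qed

theorem propositionA3:
  shows "(\<forall>p q :: ennreal. 1 \<le> q \<and> q < p \<longrightarrow> \<not> norm_P4 (wiener_norm p q)) \<and>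
    (\<forall>p q :: ennreal. 1 \<le> p \<and> p < q \<longrightarrow> \<not> norm_P5 (wiener_norm p q)) \<and>
    (\<forall>p q :: ennreal. 1 \<le> p \<and> 1 \<le> q \<longrightarrow>
      (banach_function_norm (wiener_norm p q) \<longleftrightarrow> p = q) \<and>
      (p = q \<longrightarrow> (\<forall>f\<in>meas_funs. wiener_norm p q f = Lp_norm p f)))"
proof (intro conjI allI impI ballI; (elim conjE)?)
  fix p q :: ennreal
  assume p: "1 \<le> p" and q: "1 \<le> q"
  show "banach_function_norm (wiener_norm p q) \<longleftrightarrow> p = q"
  proof
    assume "banach_function_norm (wiener_norm p q)"
    then have "norm_P4 (wiener_norm p q)" "norm_P5 (wiener_norm p q)"
      by (simp_all add: banach_function_norm_def)
    then show "p = q"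
      using not_norm_P4_wiener_norm[OF q] not_norm_P5_wiener_norm[OF p] by (metis linorder_cases)
  next
    assume "p = q"
    then show "banach_function_norm (wiener_norm p q)"
      using banach_function_norm_cong[OF wiener_norm_eq_Lp_norm[OF p]]
        banach_function_norm_Lp_norm[OF p] by simp
  qed
qed (auto simp: not_norm_P4_wiener_norm not_norm_P5_wiener_norm wiener_norm_eq_Lp_norm)

end
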